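(* Let $m\ge0$ be an integer, and let $c_n(p)=b_n-pW_n$ for $n\ge0$ (with $b_0=e^{\pi/2}$). The double inequality $$\ln\left(\frac{p}{r'}+\sum_{n=0}^{m}c_n(p)r^{2n}\right)<\mathcal{K}(r)<\ln\left(\frac{q}{r'}+\sum_{n=0}^{m}c_n(q)r^{2n}\right)$$ holds for $r\in(0,1)$ if and only if $p\le b_{m+1}/W_{m+1}$ and $q\ge4$.
   Context: $\mathcal{K}(r)=\int_0^{\pi/2}\frac{dt}{\sqrt{1-r^2\sin^2 t}}$ for $r\in(0,1)$ is the complete elliptic integral of the first kind, and $r'=\sqrt{1-r^2}$. For $n\ge0$, $W_n=\frac{(2n-1)!!}{(2n)!!}=\frac{\Gamma(n+1/2)}{\Gamma(1/2)\Gamma(n+1)}$ (so $W_0=1$); the $W_n$ are the coefficients in $1/\sqrt{1-x}=\sum_{n=0}^\infty W_nx^n$. The numbers $b_n$ ($n\ge0$) are the coefficients in the power series $e^{\mathcal{K}(\sqrt{x})}=\sum_{n=0}^\infty b_nx^n$ on $(0,1)$. Here $p,q$ are real parameters.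
   Formalization: The logarithm of a nonpositive number is read as −∞: for p < 0 the argument of the left logarithm becomes negative as r tends to 1, where the real logarithm is undefined; wherever the argument is positive it is the usual logarithm. *)

theory Defs
  imports "HOL-Analysis.Analysis"
begin

definition ellK :: "real \<Rightarrow> real" where
  "ellK r = integral {0..pi/2} (\<lambda>t. 1 / sqrt (1 - r\<^sup>2 * (sin t)\<^sup>2))"

(* The Wallis ratios (2n-1)!!/(2n)!!. *)
definition wallis :: "nat \<Rightarrow> real" where
  "wallis n = Gamma (real n + 1/2) / (Gamma (1/2) * Gamma (real n + 1))"

(* exp (ellK (sqrt x)) is analytic on the unit disc, so such a sequence exists,
   and it is unique by the identity theorem for power series. *)
definition expK_coeff :: "nat \<Rightarrow> real" where
  "expK_coeff = (THE b. \<forall>x\<in>{0<..<1}. (\<lambda>n. b n * x ^ n) sums exp (ellK (sqrt x)))"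

definition remainder_coeff :: "real \<Rightarrow> nat \<Rightarrow> real" where
  "remainder_coeff p n = expK_coeff n - p * wallis n"

(* The natural logarithm with the convention that it is -\<infinity> on nonpositive arguments.
   The library's real function ln is unsuitable here: it satisfies ln (-x) = ln x, whereas
   the argument p / r' + ... does become negative as r tends to 1 when p < 0. *)
definition ext_ln :: "real \<Rightarrow> ereal" where
  "ext_ln x = (if x > 0 then ereal (ln x) else -\<infinity>)"

end

theory Submission
  imports Defs "HOL-Real_Asymp.Real_Asymp"
begin

text \<open>
  Put \<open>x = r\<^sup>2\<close> and exponentiate. The middle term becomes \<open>F(x) = exp (K(\<surd>x)) = \<Sum> b\<^sub>n x\<^sup>n\<close>, and the outer
  terms become \<open>p / \<surd>(1 - x) = \<Sum> p W\<^sub>n x\<^sup>n\<close> (or the same with \<open>q\<close>) with the coefficients up to index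
  \<open>m\<close> replaced by those of \<open>F\<close>. So the difference to \<open>F\<close> is the tail \<open>\<Sum> W\<^sub>n (b\<^sub>n / W\<^sub>n - p) x\<^sup>n\<close> over
  \<open>n > m\<close>, and everything depends on the ratios \<open>b\<^sub>n / W\<^sub>n\<close>.

  These ratios increase strictly from index \<open>1\<close> on (\<open>expK_wallis_ratio_Suc\<close>). Hence the tail is positive
  as soon as its first coefficient is nonnegative, and letting \<open>x\<close> tend to \<open>0\<close> shows that this is
  necessary (\<open>lower_bound_iff\<close>). Near \<open>x = 1\<close> the classical asymptotics \<open>K(r) = ln (4/r') + o(1)\<close> give
  \<open>\<surd>(1 - x) F(x) \<rightarrow> 4\<close> (\<open>expK_asymptotic\<close>), while \<open>\<surd>(1 - x)\<close> times the bound tends to \<open>p\<close> or \<open>q\<close>.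
  So an upper bound requires \<open>q \<ge> 4\<close> and a lower bound requires \<open>p \<le> 4\<close>. Since each ratio is an
  admissible \<open>p\<close> in some lower bound, all ratios of positive index lie below \<open>4\<close>, and
  \<open>q \<ge> 4\<close> suffices (\<open>upper_bound_iff\<close>).

  The main difficulty is the monotonicity. It asserts that \<open>D = (1 - x) F' - F/2\<close> has positive
  coefficients from index \<open>1\<close> on. From \<open>F' = K' F\<close>, where \<open>K'\<close> is the derivative of \<open>K(\<surd>x)\<close> in
  \<open>x\<close>, one gets \<open>D = F h\<close> with \<open>h = (1 - x) K' - 1/2\<close> and \<open>D' = F (K' h + h')\<close>. The function \<open>F\<close> has
  positive coefficients, and the coefficients of \<open>K' h + h'\<close> are explicit convolutions of Wallis ratios,
  whose positivity is the elementary estimate \<open>convolution_bound\<close>.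
\<close>

section \<open>Wallis ratios and the power series of K\<close>

lemma wallis_0 [simp]: "wallis 0 = 1"
  by (simp add: wallis_def Gamma_one_half_real)

lemma wallis_Suc: "wallis (Suc n) = wallis n * (2 * real n + 1) / (2 * real n + 2)"
proof -
  have "Gamma (real n + 1/2 + 1) = (real n + 1/2) * Gamma (real n + 1/2)"
    by (rule Gamma_plus1) (auto elim!: nonpos_Ints_cases)
  moreover have "Gamma (real n + 1 + 1) = (real n + 1) * Gamma (real n + 1)"
    by (rule Gamma_plus1) (auto elim!: nonpos_Ints_cases)
  moreover have "real (Suc n) + 1/2 = real n + 1/2 + 1" "real (Suc n) + 1 = real n + 1 + 1"
    by simp_all
  ultimately have "wallis (Suc n) =
      (real n + 1/2) * Gamma (real n + 1/2) / (Gamma (1/2) * ((real n + 1) * Gamma (real n + 1)))"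
    by (simp only: wallis_def)
  also have "\<dots> = wallis n * ((real n + 1/2) / (real n + 1))"
    by (simp add: wallis_def mult_ac)
  also have "(real n + 1/2) / (real n + 1) = (2 * real n + 1) / (2 * real n + 2)"
    by (simp add: field_simps)
  finally show ?thesis by simp
qed

lemma wallis_pos: "wallis n > 0"
  by (induction n) (simp_all add: wallis_Suc)

lemma wallis_le_1: "wallis n \<le> 1"
proof (induction n)
  case (Suc n)
  have "wallis (Suc n) \<le> wallis n"
    using wallis_pos[of n] by (simp add: wallis_Suc field_simps)
  with Suc show ?case by simp
qed simp

text \<open>
  The Wallis ratio is \<open>(-1)\<^sup>n\<close> times the binomial coefficient of \<open>-1/2\<close> over \<open>n\<close>.
\<close>

lemma wallis_sums:
  assumes "\<bar>x\<bar> < 1"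
  shows "(\<lambda>n. wallis n * x ^ n) sums (1 / sqrt (1 - x))"
proof -
  have eq: "wallis n = (-1) ^ n * ((-1/2::real) gchoose n)" for n
  proof (induction n)
    case (Suc n)
    have "a * g = k * g + d * h \<Longrightarrow> d > 0 \<Longrightarrow> h = (a - k) / d * g" for a g k d h :: real
      by (simp add: field_simps)
    from this[OF gbinomial_mult_1[of "-1/2::real" n]]
    have "((-1/2::real) gchoose (Suc n)) = (-1/2 - real n) / real (Suc n) * ((-1/2) gchoose n)"
      by simp
    also have "(-1/2 - real n) / real (Suc n) = - ((2 * real n + 1) / (2 * real n + 2))"
      by (simp add: field_simps)
    finally have "((-1/2::real) gchoose (Suc n)) = - ((2 * real n + 1) / (2 * real n + 2)) * ((-1/2) gchoose n)" .
    thus ?case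
      by (simp add: Suc wallis_Suc)
  qed simp
  have "(\<lambda>n. ((-1/2) gchoose n) * (-x) ^ n) sums (1 + (-x)) powr (-1/2)"
    using assms by (intro gen_binomial_real) auto
  moreover have "(1 + (-x)) powr (-1/2) = 1 / sqrt (1 - x)"
    using powr_minus[of "1 - x" "1/2"] assms by (simp add: powr_half_sqrt inverse_eq_divide)
  moreover have "((-1/2::real) gchoose n) * (-x) ^ n = wallis n * x ^ n" for n
    by (simp add: eq power_minus[of x] mult_ac)
  ultimately show ?thesis by simp
qed

text \<open>
  Integrate the derivative of \<open>sin\<^bsup>2n+1\<^esup> cos\<close>, which vanishes at both end points; this gives the
  Wallis recursion.
\<close>

lemma integral_sin_power_even:
  "((\<lambda>t. sin t ^ (2 * n)) has_integral (pi / 2 * wallis n)) {0..pi/2}"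
proof (induction n)
  case 0
  have "((\<lambda>t::real. 1::real) has_integral pi / 2 - 0) {0..pi/2}"
    by (rule fundamental_theorem_of_calculus) (auto intro!: derivative_eq_intros)
  thus ?case by simp
next
  case (Suc n)
  have "((\<lambda>t. (2 * real n + 1) * sin t ^ (2 * n) - (2 * real n + 2) * sin t ^ (2 * Suc n)) has_integral
          (sin (pi/2) ^ (2 * n + 1) * cos (pi/2) - sin 0 ^ (2 * n + 1) * cos 0)) {0..pi/2}"
  proof (rule fundamental_theorem_of_calculus)
    fix t :: real
    have "(2 * real n + 1) * (cos t * p) * cos t + - sin t * (sin t * p) =
        (2 * real n + 1) * p - (2 * real n + 2) * (sin t * (sin t * p))" for p
    proof -
      have "(2 * real n + 1) * (cos t * p) * cos t = (2 * real n + 1) * p * (cos t)\<^sup>2"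
        by (simp only: power2_eq_square mult_ac)
      also have "\<dots> = (2 * real n + 1) * p * (1 - (sin t)\<^sup>2)"
        by (simp only: cos_squared_eq)
      finally show ?thesis by (simp add: power2_eq_square algebra_simps)
    qed
    from this[of "sin t ^ (2 * n)"]
    have "((\<lambda>t. sin t ^ (2 * n + 1) * cos t) has_real_derivative
        (2 * real n + 1) * sin t ^ (2 * n) - (2 * real n + 2) * sin t ^ (2 * Suc n)) (at t)"
      by (intro DERIV_cong[OF DERIV_mult[OF DERIV_power[OF DERIV_sin] DERIV_cos]])
        (simp add: add.commute[of 1])
    thus "((\<lambda>t. sin t ^ (2 * n + 1) * cos t) has_vector_derivative
        (2 * real n + 1) * sin t ^ (2 * n) - (2 * real n + 2) * sin t ^ (2 * Suc n)) (at t within {0..pi/2})"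
      unfolding has_real_derivative_iff_has_vector_derivative
      by (rule has_vector_derivative_at_within)
  qed simp
  hence zero: "((\<lambda>t. (2 * real n + 1) * sin t ^ (2 * n) - (2 * real n + 2) * sin t ^ (2 * Suc n)) has_integral 0) {0..pi/2}"
    by simp
  define c where "c = 2 * real n + 2"
  have c: "c \<noteq> 0" by (simp add: c_def)
  have "((\<lambda>t. c * sin t ^ (2 * Suc n)) has_integral (2 * real n + 1) * (pi / 2 * wallis n) - 0) {0..pi/2}"
    using has_integral_diff[OF has_integral_mult_right[OF Suc, of "2 * real n + 1"] zero]
    unfolding c_def by (simp only: diff_diff_eq2 add_diff_cancel_left')
  from has_integral_mult_right[OF this, of "1 / c"]
  have "((\<lambda>t. sin t ^ (2 * Suc n)) has_integral 1 / c * ((2 * real n + 1) * (pi / 2 * wallis n) - 0)) {0..pi/2}"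
    by (rule has_integral_eq[rotated]) (use c in simp)
  moreover have "1 / c * ((2 * real n + 1) * (pi / 2 * wallis n) - 0) = pi / 2 * wallis (Suc n)"
    by (simp add: wallis_Suc c_def mult_ac)
  ultimately show ?case by (simp only:)
qed

text \<open>
  Coefficients of \<open>K(\<surd>x)\<close>: expanding the integrand binomially contributes one Wallis ratio
  and integrating the even power of the sine contributes the other.
\<close>

definition ellK_coeff :: "nat \<Rightarrow> real" where
  "ellK_coeff n = pi / 2 * (wallis n)\<^sup>2"

text \<open>
  Integrate the binomial series of \<open>(1 - x sin\<^sup>2 t)\<^bsup>-1/2\<^esup>\<close> term by term. For fixed \<open>x < 1\<close> it
  converges uniformly in \<open>t\<close>, dominated by the geometric series.
\<close>

lemma ellK_sums:
  assumes "0 \<le> x" "x < 1"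
  shows "(\<lambda>n. ellK_coeff n * x ^ n) sums ellK (sqrt x)"
proof -
  define f where "f = (\<lambda>N t. \<Sum>n<N. wallis n * (x * (sin t)\<^sup>2) ^ n)"
  define g where "g = (\<lambda>t. 1 / sqrt (1 - (sqrt x)\<^sup>2 * (sin t)\<^sup>2))"
  have less: "0 \<le> x * (sin t)\<^sup>2 \<and> x * (sin t)\<^sup>2 \<le> x" for t :: real
    using assms by (simp add: mult_left_le abs_square_le_1)
  have "uniform_limit {0..pi/2} f (\<lambda>t. \<Sum>n. wallis n * (x * (sin t)\<^sup>2) ^ n) sequentially"
    unfolding f_def
  proof (rule Weierstrass_m_test)
    fix n and t :: real
    have "wallis n * (x * (sin t)\<^sup>2) ^ n \<le> 1 * x ^ n"
      using less[of t] wallis_pos[of n] wallis_le_1[of n]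
      by (intro mult_mono power_mono) auto
    thus "norm (wallis n * (x * (sin t)\<^sup>2) ^ n) \<le> x ^ n"
      using less[of t] wallis_pos[of n] by simp
  next
    show "summable (\<lambda>n. x ^ n)" using assms by (simp add: summable_geometric)
  qed
  moreover have "(\<Sum>n. wallis n * (x * (sin t)\<^sup>2) ^ n) = g t" for t
    using wallis_sums[of "x * (sin t)\<^sup>2"] less[of t] assms unfolding g_def
    by (simp add: sums_iff)
  ultimately have "uniform_limit {0..pi/2} f g sequentially" by simp
  moreover have "continuous_on {0..pi/2} (f N)" for N
    unfolding f_def by (intro continuous_intros)
  ultimately obtain I J where I: "\<And>N. (f N has_integral I N) {0..pi/2}"
    and J: "(g has_integral J) {0..pi/2}" and lim: "I \<longlonglongrightarrow> J"
    by (elim uniform_limit_integral) auto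
  have "(f N has_integral (\<Sum>n<N. ellK_coeff n * x ^ n)) {0..pi/2}" for N
    unfolding f_def
  proof (intro has_integral_sum)
    fix n
    from has_integral_mult_right[OF integral_sin_power_even[of n], of "wallis n * x ^ n"]
    show "((\<lambda>t. wallis n * (x * (sin t)\<^sup>2) ^ n) has_integral ellK_coeff n * x ^ n) {0..pi/2}"
      by (simp add: ellK_coeff_def power_mult_distrib power_mult power2_eq_square mult_ac)
  qed simp
  hence "I = (\<lambda>N. \<Sum>n<N. ellK_coeff n * x ^ n)"
    using I has_integral_unique by blast
  moreover have "J = ellK (sqrt x)"
    using J unfolding g_def ellK_def by (simp add: integral_unique)
  ultimately show ?thesis
    using lim by (simp add: sums_def)
qed

section \<open>The coefficients of the derivative of K\<close>

text \<open>
  With its index shifted by one, this is the coefficient sequence of the derivative of \<open>K(\<surd>x)\<close>.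
  By Wallis' product it increases to \<open>1/2\<close>, in accordance with the leading term
  \<open>-(1/2) ln (1 - x)\<close> of \<open>K(\<surd>x)\<close> near \<open>1\<close>.
\<close>

definition scaled_coeff :: "nat \<Rightarrow> real" where
  "scaled_coeff n = real n * ellK_coeff n"

lemma scaled_coeff_0 [simp]: "scaled_coeff 0 = 0"
  by (simp add: scaled_coeff_def)

lemma scaled_coeff_1: "scaled_coeff (Suc 0) = pi / 8"
  by (simp add: scaled_coeff_def ellK_coeff_def wallis_Suc power2_eq_square)

lemma scaled_coeff_pos: "n > 0 \<Longrightarrow> scaled_coeff n > 0"
  using wallis_pos[of n] by (simp add: scaled_coeff_def ellK_coeff_def)

lemma scaled_coeff_Suc:
  assumes "n > 0"
  shows "scaled_coeff (Suc n) - scaled_coeff n = scaled_coeff n / (4 * real n * (real n + 1))"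
proof -
  have "scaled_coeff (Suc n) = scaled_coeff n * (2 * real n + 1)\<^sup>2 / (4 * real n * (real n + 1))"
    using assms by (simp add: scaled_coeff_def ellK_coeff_def wallis_Suc power2_eq_square divide_simps)
      (simp add: algebra_simps)
  moreover have "(2 * real n + 1)\<^sup>2 = 4 * real n * (real n + 1) + 1"
    by (simp add: power2_eq_square algebra_simps)
  ultimately have "scaled_coeff (Suc n) = scaled_coeff n * (4 * real n * (real n + 1) + 1) / (4 * real n * (real n + 1))"
    by (simp only:)
  moreover have "c * (d + 1) / d - c = c / d" if "d \<noteq> 0" for c d :: real
    using that by (simp add: field_simps)
  ultimately show ?thesis using assms by simp
qed

lemma scaled_coeff_strict_mono: "strict_mono scaled_coeff"
proof (rule strict_mono_Suc_iff[THEN iffD2, rule_format])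
  fix n show "scaled_coeff n < scaled_coeff (Suc n)"
  proof (cases "n = 0")
    case False
    hence "scaled_coeff (Suc n) - scaled_coeff n > 0"
      using scaled_coeff_pos[of n] by (subst scaled_coeff_Suc) auto
    thus ?thesis by simp
  qed (simp add: scaled_coeff_1)
qed

text \<open>
  The partial products in Wallis' formula are \<open>1 / ((2n+1) W\<^sub>n\<^sup>2)\<close>.
\<close>

lemma scaled_coeff_limit: "scaled_coeff \<longlonglongrightarrow> 1 / 2"
proof -
  have prod: "(\<Prod>k=1..n. (4 * real k ^ 2) / (4 * real k ^ 2 - 1)) = 1 / ((2 * real n + 1) * (wallis n)\<^sup>2)" for n
  proof (induction n)
    case (Suc n)
    have "4 * real (Suc n) ^ 2 - 1 = (2 * real n + 1) * (2 * real n + 3)"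
      by (simp add: power2_eq_square algebra_simps)
    moreover have "4 * real (Suc n) ^ 2 = (2 * real n + 2)\<^sup>2"
      by (simp add: power2_eq_square algebra_simps)
    moreover have "(\<Prod>k=1..Suc n. (4 * real k ^ 2) / (4 * real k ^ 2 - 1)) =
        1 / ((2 * real n + 1) * (wallis n)\<^sup>2) * (4 * real (Suc n) ^ 2 / (4 * real (Suc n) ^ 2 - 1))"
      using Suc by simp
    ultimately have "(\<Prod>k=1..Suc n. (4 * real k ^ 2) / (4 * real k ^ 2 - 1)) =
        1 / ((2 * real n + 1) * (wallis n)\<^sup>2) * ((2 * real n + 2)\<^sup>2 / ((2 * real n + 1) * (2 * real n + 3)))"
      by metis
    also have "\<dots> = 1 / ((2 * real n + 3) * (wallis n * (2 * real n + 1) / (2 * real n + 2))\<^sup>2)"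
      by (simp add: power_divide power_mult_distrib power2_eq_square mult_ac)
    finally show ?case
      by (simp add: wallis_Suc add_ac)
  qed simp
  have ratio: "(\<lambda>n. real n / (2 * real n + 1)) \<longlonglongrightarrow> 1 / 2"
    by real_asymp
  have "(\<lambda>n. 1 / (\<Prod>k=1..n. (4 * real k ^ 2) / (4 * real k ^ 2 - 1)) * (pi / 2) * (real n / (2 * real n + 1)))
     \<longlonglongrightarrow> 1 / (pi / 2) * (pi / 2) * (1 / 2)"
    by (intro tendsto_mult tendsto_divide tendsto_const wallis ratio) simp_all
  thus ?thesis
    unfolding prod by (simp add: scaled_coeff_def[abs_def] ellK_coeff_def mult_ac)
qed

lemma scaled_coeff_less_half: "scaled_coeff n < 1 / 2"
proof -
  have "scaled_coeff n < scaled_coeff (Suc n)"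
    using scaled_coeff_strict_mono by (simp add: strict_mono_def)
  also have "\<dots> \<le> 1 / 2"
    using scaled_coeff_strict_mono scaled_coeff_limit
    by (intro incseq_le) (auto dest: strict_mono_mono)
  finally show ?thesis .
qed

text \<open>
  The quotient of \<open>scaled_coeff\<close> by \<open>1/2 - 1/(8n+1)\<close> decreases and tends to \<open>1\<close>, hence is at
  least \<open>1\<close>. The true defect is asymptotic to \<open>1/(8n)\<close>; the summand \<open>+1\<close> is what makes the
  comparison \<open>convolution_bound\<close> succeed at \<open>n = 0\<close>.
\<close>

lemma half_minus_scaled_coeff_le:
  assumes "n > 0"
  shows "1 / 2 - scaled_coeff n \<le> 1 / (8 * real n + 1)"
proof -
  define g where "g = (\<lambda>n. 1 / 2 - 1 / (8 * real n + 1))"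
  define \<rho> where "\<rho> = (\<lambda>n. scaled_coeff (Suc n) / g (Suc n))"
  have g: "g k = (8 * real k - 1) / (2 * (8 * real k + 1))" for k
    by (simp add: g_def field_simps)
  have gpos: "g (Suc k) > 0" for k
    by (simp add: g)
  have "\<rho> (Suc k) \<le> \<rho> k" for k
  proof -
    define y where "y = real (Suc k)"
    have y: "y \<ge> 1" by (simp add: y_def)
    have "scaled_coeff (Suc (Suc k)) = scaled_coeff (Suc k) * (1 + 1 / (4 * y * (y + 1)))"
      using scaled_coeff_Suc[of "Suc k"] by (simp add: y_def algebra_simps)
    moreover have "(1 + 1 / (4 * y * (y + 1))) * g (Suc k) \<le> g (Suc (Suc k))"
    proof -
      have "g (Suc k) = (8 * y - 1) / (2 * (8 * y + 1))" "g (Suc (Suc k)) = (8 * y + 7) / (2 * (8 * y + 9))"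
        by (simp_all add: g y_def algebra_simps)
      moreover have "(1 + 1 / (4 * y * (y + 1))) * ((8 * y - 1) / (2 * (8 * y + 1))) \<le> (8 * y + 7) / (2 * (8 * y + 9))"
        using y by (simp add: divide_simps) (simp add: algebra_simps)
      ultimately show ?thesis by simp
    qed
    ultimately have "scaled_coeff (Suc (Suc k)) * g (Suc k) \<le> scaled_coeff (Suc k) * g (Suc (Suc k))"
      using scaled_coeff_pos[of "Suc k"] by (simp add: mult.assoc)
    thus ?thesis
      using gpos[of k] gpos[of "Suc k"] by (simp add: \<rho>_def field_simps)
  qed
  hence "decseq \<rho>" by (rule decseq_SucI)
  moreover have "\<rho> \<longlonglongrightarrow> (1 / 2) / (1 / 2)"
    unfolding \<rho>_def
  proof (intro tendsto_divide LIMSEQ_Suc[OF scaled_coeff_limit])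
    show "(\<lambda>n. g (Suc n)) \<longlonglongrightarrow> 1 / 2" unfolding g_def by real_asymp
  qed simp
  ultimately have "1 \<le> \<rho> k" for k by (auto intro: decseq_ge)
  from this[of "n - 1"] assms gpos[of "n - 1"] have "scaled_coeff n \<ge> g n"
    by (simp add: \<rho>_def field_simps)
  thus ?thesis by (simp add: g_def)
qed

text \<open>
  The coefficients of \<open>(1 - x) K'\<close>, where \<open>K'\<close> is the derivative of \<open>K(\<surd>x)\<close>.
\<close>

definition coeff_incr :: "nat \<Rightarrow> real" where
  "coeff_incr n = scaled_coeff (Suc n) - scaled_coeff n"

lemma sum_coeff_incr: "(\<Sum>j\<le>n. coeff_incr j) = scaled_coeff (Suc n)"
  unfolding coeff_incr_def using sum_lessThan_telescope[of scaled_coeff "Suc n"]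
  by (simp add: lessThan_Suc_atMost)

lemma coeff_incr_Suc: "(real n + 1) * coeff_incr (Suc n) = scaled_coeff (Suc n) / (4 * (real n + 2))"
proof -
  have "coeff_incr (Suc n) = scaled_coeff (Suc n) / (4 * (real n + 1) * (real n + 2))"
    using scaled_coeff_Suc[of "Suc n"] by (simp add: coeff_incr_def add_ac)
  thus ?thesis
    by (simp add: divide_simps) (simp add: algebra_simps)
qed

text \<open>
  The estimate behind the monotonicity of \<open>b\<^sub>n / W\<^sub>n\<close>. Write \<open>s\<close> for \<open>scaled_coeff\<close> and \<open>v\<close> for
  \<open>coeff_incr\<close>. The right-hand side is \<open>s\<^bsub>n+1\<^esub> / (4(n+2))\<close>, about \<open>1/(8n)\<close>, whereas the left-hand
  side is about half of that, because the large \<open>v\<^sub>j\<close> (small \<open>j\<close>) meet defects \<open>1/2 - s\<close> of size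
  \<open>1/(8n)\<close> and sum up to \<open>1/2\<close>. The slack permits crude bounds: the summand \<open>j = 0\<close> is kept almost
  exactly, and the others are estimated by \<open>v\<^sub>j \<le> 1/(8j(j+1))\<close> and \<open>1/2 - s\<^sub>k \<le> 1/(8k)\<close>, after
  which partial fractions give a sum of order \<open>1/(32n)\<close>. What is left is a polynomial inequality
  that follows from \<open>v\<^sub>0 = \<pi>/8 > 3/8\<close>.
\<close>

lemma convolution_bound:
  "(\<Sum>j\<le>n. coeff_incr j * (1 / 2 - scaled_coeff (Suc (n - j)))) < (real n + 1) * coeff_incr (Suc n)"
proof -
  define N where "N = real n"
  have N: "N \<ge> 0" by (simp add: N_def)
  have v0: "coeff_incr 0 = pi / 8" by (simp add: coeff_incr_def scaled_coeff_1)
  have v0_nonneg: "coeff_incr 0 \<ge> 0" unfolding v0 using pi_ge_zero by simp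
  have head: "coeff_incr 0 * (1 / 2 - scaled_coeff (Suc n)) \<le> coeff_incr 0 * (1 / (8 * N + 9))"
    using half_minus_scaled_coeff_le[of "Suc n"] v0_nonneg by (intro mult_left_mono) (auto simp: N_def algebra_simps)
  have term_le: "coeff_incr j * (1 / 2 - scaled_coeff (Suc (n - j)))
        \<le> 1 / (64 * (N + 1)) * (1 / real j - 1 / real (Suc j)) + 1 / (64 * (N + 1)\<^sup>2)"
    if j: "j \<in> {1..n}" for j
  proof -
    define J where "J = real j"
    have J: "1 \<le> J" "J \<le> N" using j by (auto simp: J_def N_def)
    have "coeff_incr j = scaled_coeff j / (4 * J * (J + 1))"
      using scaled_coeff_Suc[of j] j by (simp add: coeff_incr_def J_def)
    also have "\<dots> \<le> (1 / 2) / (4 * J * (J + 1))"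
      using scaled_coeff_less_half[of j] J by (intro divide_right_mono) auto
    finally have "coeff_incr j \<le> (1 / 2) / (4 * J * (J + 1))" .
    moreover have "1 / 2 - scaled_coeff (Suc (n - j)) \<le> 1 / (8 * (N + 1 - J))"
    proof -
      have "real (Suc (n - j)) = N + 1 - J" using j by (simp add: N_def J_def of_nat_diff)
      hence "1 / 2 - scaled_coeff (Suc (n - j)) \<le> 1 / (8 * (N + 1 - J) + 1)"
        using half_minus_scaled_coeff_le[of "Suc (n - j)"] by simp
      also have "\<dots> \<le> 1 / (8 * (N + 1 - J))"
        using J by (intro divide_left_mono) auto
      finally show ?thesis .
    qed
    ultimately have "coeff_incr j * (1 / 2 - scaled_coeff (Suc (n - j)))
        \<le> (1 / 2) / (4 * J * (J + 1)) * (1 / (8 * (N + 1 - J)))"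
      using scaled_coeff_less_half[of "Suc (n - j)"] J
      by (intro mult_mono) auto
    also have "\<dots> = 1 / (64 * (N + 1)) * (1 / J - 1 / (J + 1)) + 1 / (64 * (N + 1)) * (1 / ((J + 1) * (N + 1 - J)))"
    proof -
      have "1 / (J * (N + 1 - J)) = 1 / (N + 1) * (1 / J + 1 / (N + 1 - J))"
        using J by (simp add: divide_simps)
      hence "1 / (64 * (J + 1)) * (1 / (J * (N + 1 - J))) = 1 / (64 * (J + 1)) * (1 / (N + 1) * (1 / J + 1 / (N + 1 - J)))"
        by simp
      moreover have "1 / J - 1 / (J + 1) = 1 / (J + 1) * (1 / J)"
        using J by (simp add: divide_simps)
      ultimately show ?thesis by (simp add: algebra_simps)
    qed
    also have "1 / (64 * (N + 1)) * (1 / ((J + 1) * (N + 1 - J))) \<le> 1 / (64 * (N + 1)) * (1 / (N + 1))"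
    proof (rule mult_left_mono)
      \<comment> \<open>The product \<open>(J + 1) (N + 1 - J)\<close> exceeds \<open>N + 1\<close> by \<open>J (N - J)\<close>.\<close>
      have "0 \<le> J * (N - J)" using J by simp
      hence "N + 1 \<le> (J + 1) * (N + 1 - J)" by (simp add: algebra_simps)
      thus "1 / ((J + 1) * (N + 1 - J)) \<le> 1 / (N + 1)" using J by (intro divide_left_mono) auto
    qed (use N in simp)
    also have "1 / (64 * (N + 1)) * (1 / (N + 1)) = 1 / (64 * (N + 1)\<^sup>2)"
      by (simp add: power2_eq_square)
    also have "J + 1 = real (Suc j)" by (simp add: J_def)
    finally show ?thesis by (simp only: J_def)
  qed
  have "(\<Sum>j=1..n. coeff_incr j * (1 / 2 - scaled_coeff (Suc (n - j))))
      \<le> (\<Sum>j=1..n. 1 / (64 * (N + 1)) * (1 / real j - 1 / real (Suc j)) + 1 / (64 * (N + 1)\<^sup>2))"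
    by (intro sum_mono term_le)
  also have "\<dots> = 1 / (64 * (N + 1)) * (\<Sum>j=1..n. 1 / real j - 1 / real (Suc j)) + N / (64 * (N + 1)\<^sup>2)"
    by (simp only: sum.distrib sum_distrib_left) (simp add: N_def)
  also have "(\<Sum>j=1..n. 1 / real j - 1 / real (Suc j)) = 1 - 1 / real (Suc n)"
    by (induction n) simp_all
  also have "real (Suc n) = N + 1"
    by (simp add: N_def)
  also have "1 / (64 * (N + 1)) * (1 - 1 / (N + 1)) + N / (64 * (N + 1)\<^sup>2) = N / (32 * (N + 1)\<^sup>2)"
    using N by (simp add: divide_simps power2_eq_square)
  finally have tail: "(\<Sum>j=1..n. coeff_incr j * (1 / 2 - scaled_coeff (Suc (n - j)))) \<le> N / (32 * (N + 1)\<^sup>2)" .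
  have "{..n} = insert 0 {1..n}" by auto
  hence "(\<Sum>j\<le>n. coeff_incr j * (1 / 2 - scaled_coeff (Suc (n - j)))) =
      coeff_incr 0 * (1 / 2 - scaled_coeff (Suc n)) + (\<Sum>j=1..n. coeff_incr j * (1 / 2 - scaled_coeff (Suc (n - j))))"
    by (simp only: sum.insert finite_atLeastAtMost diff_zero) simp
  also have "\<dots> \<le> coeff_incr 0 * (1 / (8 * N + 9)) + N / (32 * (N + 1)\<^sup>2)"
    by (rule add_mono[OF head tail])
  also have "\<dots> < coeff_incr 0 / (4 * (N + 2))"
  proof -
    \<comment> \<open>Cleared of denominators this reads \<open>N (N + 2) (8 N + 9) < 3 (4 N + 1) (N + 1)\<^sup>2\<close>.\<close>
    have "N / (32 * (N + 1)\<^sup>2) < 3 / 8 * ((4 * N + 1) / (4 * (N + 2) * (8 * N + 9)))"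
      using N by (simp add: divide_simps power2_eq_square) (simp add: algebra_simps add_pos_nonneg)
    also have "\<dots> \<le> pi / 8 * ((4 * N + 1) / (4 * (N + 2) * (8 * N + 9)))"
      using N pi_gt3 by (intro mult_right_mono) auto
    also have "(4 * N + 1) / (4 * (N + 2) * (8 * N + 9)) = 1 / (4 * (N + 2)) - 1 / (8 * N + 9)"
      using N by (simp add: divide_simps)
    finally show ?thesis by (simp add: v0 algebra_simps)
  qed
  also have "\<dots> \<le> scaled_coeff (Suc n) / (4 * (N + 2))"
    using N monoD[OF strict_mono_mono[OF scaled_coeff_strict_mono], of "Suc 0" "Suc n"]
    by (intro divide_right_mono) (simp_all add: coeff_incr_def)
  also have "\<dots> = (real n + 1) * coeff_incr (Suc n)"
    by (simp only: coeff_incr_Suc N_def)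
  finally show ?thesis .
qed

section \<open>Behaviour of K at the singularity\<close>

text \<open>
  Split the numerator \<open>1\<close> of the integrand as \<open>sin t + (1 - sin t)\<close>. The first part has an
  elementary antiderivative and carries the logarithmic singularity; the second stays bounded as
  \<open>r\<close> tends to \<open>1\<close> and differs from \<open>cos t / (1 + sin t)\<close> by at most \<open>r'\<close>.
\<close>

lemma ellK_bounds:
  fixes r :: real
  assumes r: "0 < r" "r < 1"
  defines "r' \<equiv> sqrt (1 - r\<^sup>2)"
  shows "ellK r \<le> arsinh (r / r') / r + ln 2"
    and "arsinh (r / r') / r + ln 2 - pi / 2 * r' \<le> ellK r"
proof -
  define S where "S = (\<lambda>t. sqrt (1 - r\<^sup>2 * (sin t)\<^sup>2))"
  have r2: "0 < r\<^sup>2" "r\<^sup>2 < 1" using r by (simp_all add: abs_square_less_1)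
  hence r': "0 < r'" "r' \<le> 1" and r'sq: "r'\<^sup>2 = 1 - r\<^sup>2" by (simp_all add: r'_def)
  have arg: "1 - r\<^sup>2 * (sin t)\<^sup>2 = (cos t)\<^sup>2 + r'\<^sup>2 * (sin t)\<^sup>2" for t
    by (simp add: r'sq cos_squared_eq algebra_simps)
  have argpos: "1 - r\<^sup>2 * (sin t)\<^sup>2 > 0" for t
  proof -
    have "r\<^sup>2 * (sin t)\<^sup>2 \<le> r\<^sup>2 * 1" using r2 by (intro mult_left_mono) (auto simp: abs_square_le_1)
    with r2 show ?thesis by linarith
  qed
  have Spos: "S t > 0" for t using argpos[of t] by (simp add: S_def)
  have Ssq: "(S t)\<^sup>2 = (cos t)\<^sup>2 + r'\<^sup>2 * (sin t)\<^sup>2" for t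
    using argpos[of t] by (simp add: S_def arg)
  have contS: "continuous_on A S" for A unfolding S_def by (intro continuous_intros)
  have trig: "0 \<le> sin t" "sin t \<le> 1" "0 \<le> cos t" if "t \<in> {0..pi/2}" for t
    using that by (auto intro!: sin_ge_zero cos_ge_zero)
  have int_K: "((\<lambda>t. 1 / S t) has_integral ellK r) {0..pi/2}"
  proof -
    have "(\<lambda>t. 1 / S t) integrable_on {0..pi/2}"
      using Spos by (intro integrable_continuous_real continuous_intros contS) (auto simp: less_imp_neq[symmetric])
    thus ?thesis
      unfolding ellK_def S_def by (rule integrable_integral)
  qed
  have int_sin: "((\<lambda>t. sin t / S t) has_integral arsinh (r / r') / r) {0..pi/2}"
  proof -
    have "((\<lambda>t. sin t / S t) has_integral
        (- arsinh (r * cos (pi/2) / r') / r - (- arsinh (r * cos 0 / r') / r))) {0..pi/2}"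
    proof (rule fundamental_theorem_of_calculus)
      fix t assume t: "t \<in> {0..pi/2}"
      have "(r * cos t / r')\<^sup>2 + 1 = (S t / r')\<^sup>2"
      proof -
        have "(r * cos t)\<^sup>2 + r'\<^sup>2 = (S t)\<^sup>2"
          unfolding Ssq power_mult_distrib r'sq by (simp add: sin_squared_eq algebra_simps)
        thus ?thesis using r' by (simp add: power_divide add_divide_distrib[symmetric] field_simps)
      qed
      hence sq: "sqrt ((r * cos t / r')\<^sup>2 + 1) = S t / r'"
        using Spos[of t] r' by simp
      have "((\<lambda>t. arsinh (r * cos t / r')) has_real_derivative
              1 / sqrt ((r * cos t / r')\<^sup>2 + 1) * (r * (- sin t) / r')) (at t)"
        by (intro DERIV_chain2[OF arsinh_real_has_field_derivative] DERIV_cdivide DERIV_cmult DERIV_cos)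
      hence "((\<lambda>t. - arsinh (r * cos t / r') / r) has_real_derivative
              - (1 / sqrt ((r * cos t / r')\<^sup>2 + 1) * (r * (- sin t) / r')) / r) (at t)"
        by (intro DERIV_cdivide DERIV_minus)
      moreover have "- (1 / sqrt ((r * cos t / r')\<^sup>2 + 1) * (r * (- sin t) / r')) / r = sin t / S t"
        unfolding sq using r r' Spos[of t] by simp
      ultimately show "((\<lambda>t. - arsinh (r * cos t / r') / r) has_vector_derivative sin t / S t)
          (at t within {0..pi/2})"
        by (simp add: has_real_derivative_iff_has_vector_derivative has_vector_derivative_at_within)
    qed simp
    thus ?thesis by simp
  qed
  \<comment> \<open>This is \<open>(1 - sin t) / cos t\<close>, the limit of the remaining integrand as \<open>r\<close> tends to \<open>1\<close>,
    written without the removable singularity at \<open>\<pi>/2\<close>.\<close>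
  have int_log: "((\<lambda>t. cos t / (1 + sin t)) has_integral ln 2) {0..pi/2}"
  proof -
    have "((\<lambda>t. cos t / (1 + sin t)) has_integral (ln (1 + sin (pi/2)) - ln (1 + sin 0))) {0..pi/2}"
    proof (rule fundamental_theorem_of_calculus)
      fix t assume t: "t \<in> {0..pi/2}"
      have "((\<lambda>t. ln (1 + sin t)) has_real_derivative cos t / (1 + sin t)) (at t)"
        using trig[OF t] by (auto intro!: derivative_eq_intros)
      thus "((\<lambda>t. ln (1 + sin t)) has_vector_derivative cos t / (1 + sin t)) (at t within {0..pi/2})"
        by (simp add: has_real_derivative_iff_has_vector_derivative has_vector_derivative_at_within)
    qed simp
    thus ?thesis by simp
  qed
  have int_rest: "((\<lambda>t. (1 - sin t) / S t) has_integral (ellK r - arsinh (r / r') / r)) {0..pi/2}"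
    using has_integral_diff[OF int_K int_sin] by (simp add: diff_divide_distrib)
  have cos_le: "cos t \<le> S t" if t: "t \<in> {0..pi/2}" for t
    by (rule power2_le_imp_le) (use Spos[of t] in \<open>auto simp: Ssq\<close>)
  have cos_eq: "(1 - sin t) * (1 + sin t) = cos t * cos t" for t :: real
    using cos_squared_eq[of t] by (simp add: power2_eq_square algebra_simps)
  have "ellK r - arsinh (r / r') / r \<le> ln 2"
  proof (rule has_integral_le[OF int_rest int_log])
    fix t assume t: "t \<in> {0..pi/2}"
    have "(1 - sin t) * (1 + sin t) \<le> cos t * S t"
      unfolding cos_eq using cos_le[OF t] trig[OF t] by (intro mult_left_mono)
    thus "(1 - sin t) / S t \<le> cos t / (1 + sin t)"
      using Spos[of t] trig[OF t] by (simp add: divide_simps)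
  qed
  thus "ellK r \<le> arsinh (r / r') / r + ln 2" by simp
  have "((\<lambda>t. cos t / (1 + sin t) - r') has_integral (ln 2 - (pi / 2) * r')) {0..pi/2}"
    using has_integral_diff[OF int_log has_integral_const_real[of r' 0 "pi/2"]] by simp
  hence "ln 2 - pi / 2 * r' \<le> ellK r - arsinh (r / r') / r"
  proof (rule has_integral_le[OF _ int_rest])
    fix t assume t: "t \<in> {0..pi/2}"
    have "S t \<le> cos t + r'"
    proof (rule power2_le_imp_le)
      have "r'\<^sup>2 * (sin t)\<^sup>2 \<le> r'\<^sup>2 * 1" by (intro mult_left_mono) (auto simp: abs_square_le_1)
      moreover have "0 \<le> 2 * cos t * r'" using trig[OF t] r' by simp
      ultimately show "(S t)\<^sup>2 \<le> (cos t + r')\<^sup>2" unfolding Ssq by (simp add: power2_sum mult_ac)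
    qed (use trig[OF t] r' in auto)
    hence "cos t * (S t - cos t) \<le> cos t * r'"
      using trig[OF t] by (intro mult_left_mono) auto
    also have "\<dots> \<le> S t * r'" using cos_le[OF t] r' by (intro mult_right_mono) auto
    also have "\<dots> \<le> S t * r' * (1 + sin t)"
      using trig[OF t] Spos[of t] r' by simp
    finally have "cos t * S t \<le> S t * r' * (1 + sin t) + (1 - sin t) * (1 + sin t)"
      unfolding cos_eq by (simp add: algebra_simps)
    moreover have "1 + sin t > 0" using trig[OF t] by simp
    ultimately have "cos t / (1 + sin t) \<le> (S t * r' + (1 - sin t)) / S t"
      using Spos[of t] by (simp add: divide_simps) (simp add: algebra_simps)
    thus "cos t / (1 + sin t) - r' \<le> (1 - sin t) / S t"
      using Spos[of t] by (simp add: add_divide_distrib)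
  qed
  thus "arsinh (r / r') / r + ln 2 - pi / 2 * r' \<le> ellK r" by simp
qed

text \<open>
  Equivalently \<open>K(r) - ln (4/r')\<close> tends to \<open>0\<close>. The \<open>arsinh\<close> term of the bounds above supplies
  \<open>ln (2/r') + o(1)\<close> and the bounded part supplies \<open>ln 2\<close>. This is where the constant \<open>4\<close> comes from.
\<close>

lemma expK_asymptotic:
  "((\<lambda>x. sqrt (1 - x) * exp (ellK (sqrt x))) \<longlongrightarrow> 4) (at_left 1)"
proof -
  define L where "L = (\<lambda>x. ln (1 + sqrt x) / sqrt x + (1 - 1 / sqrt x) * ln (sqrt (1 - x)) + ln 2 :: real)"
  have L: "arsinh (sqrt x / sqrt (1 - x)) / sqrt x + ln 2 + ln (sqrt (1 - x)) = L x"
    if x: "0 < x" "x < 1" for x :: real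
  proof -
    have "(sqrt x / sqrt (1 - x))\<^sup>2 + 1 = (1 / sqrt (1 - x))\<^sup>2"
      using x by (simp add: power_divide field_simps)
    hence "arsinh (sqrt x / sqrt (1 - x)) = ln ((1 + sqrt x) / sqrt (1 - x))"
      using x by (simp add: arsinh_real_def add_divide_distrib[symmetric] real_sqrt_divide add.commute)
    also have "\<dots> = ln (1 + sqrt x) - ln (sqrt (1 - x))"
      using x by (intro ln_divide_pos) (auto intro: add_pos_nonneg)
    finally have arsinh_eq: "arsinh (sqrt x / sqrt (1 - x)) = ln (1 + sqrt x) - ln (sqrt (1 - x))" .
    have "(a - b) / s + l + b = a / s + (1 - 1 / s) * b + l" for a b s l :: real
      by (simp add: diff_divide_distrib left_diff_distrib)
    thus ?thesis unfolding L_def arsinh_eq .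
  qed
  have ev: "\<forall>\<^sub>F x::real in at_left 1. 0 < x \<and> x < 1"
    using eventually_at_left_real[of 0 1] by simp
  have "((\<lambda>x. exp (L x)) \<longlongrightarrow> exp (ln 2 + ln 2)) (at_left 1)"
    unfolding L_def by (intro tendsto_exp) real_asymp
  moreover have "((\<lambda>x. exp (L x - pi / 2 * sqrt (1 - x))) \<longlongrightarrow> exp (ln 2 + ln 2)) (at_left 1)"
    unfolding L_def by (intro tendsto_exp) real_asymp
  moreover have "exp (ln 2 + ln 2) = (4::real)" by (simp only: exp_add exp_ln zero_less_numeral)
  ultimately have lims: "((\<lambda>x. exp (L x)) \<longlongrightarrow> 4) (at_left 1)"
      "((\<lambda>x. exp (L x - pi / 2 * sqrt (1 - x))) \<longlongrightarrow> 4) (at_left 1)" by simp_all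
  have E: "sqrt (1 - x) * exp (ellK (sqrt x)) = exp (ln (sqrt (1 - x)) + ellK (sqrt x))" if "x < 1" for x
    using that by (simp add: exp_add)
  show ?thesis
  proof (rule tendsto_sandwich[OF _ _ lims(2) lims(1)])
    show "\<forall>\<^sub>F x in at_left 1. exp (L x - pi / 2 * sqrt (1 - x)) \<le> sqrt (1 - x) * exp (ellK (sqrt x))"
      using ev
    proof eventually_elim
      case (elim x)
      thus ?case using ellK_bounds(2)[of "sqrt x"] L[of x] by (simp add: E)
    qed
    show "\<forall>\<^sub>F x in at_left 1. sqrt (1 - x) * exp (ellK (sqrt x)) \<le> exp (L x)"
      using ev
    proof eventually_elim
      case (elim x)
      thus ?case using ellK_bounds(1)[of "sqrt x"] L[of x] by (simp add: E)
    qed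
  qed
qed

section \<open>The exponential of K as a power series\<close>

definition ellK_fps :: "real fps" where
  "ellK_fps = Abs_fps ellK_coeff"

text \<open>
  The value \<open>K(0) = \<pi>/2\<close> is split off because formal composition requires an inner series with
  zero constant term.
\<close>

definition expK_fps :: "real fps" where
  "expK_fps = fps_const (exp (pi / 2)) * (fps_exp 1 oo (ellK_fps - fps_const (pi / 2)))"

lemma ellK_coeff_0: "ellK_coeff 0 = pi / 2"
  by (simp add: ellK_coeff_def)

lemma expK_fps_deriv: "fps_deriv expK_fps = expK_fps * fps_deriv ellK_fps"
proof -
  have "fps_nth (ellK_fps - fps_const (pi / 2)) 0 = 0"
    by (simp add: ellK_fps_def ellK_coeff_0)
  thus ?thesis
    by (simp add: expK_fps_def fps_compose_deriv mult_ac)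
qed

lemma expK_fps_nth_0: "fps_nth expK_fps 0 = exp (pi / 2)"
  by (simp add: expK_fps_def fps_compose_nth)

lemma ellK_fps_deriv_nth: "fps_nth (fps_deriv ellK_fps) n = scaled_coeff (Suc n)"
  by (simp add: ellK_fps_def scaled_coeff_def)

lemma expK_fps_nth_Suc:
  "real (Suc n) * fps_nth expK_fps (Suc n) = (\<Sum>i\<le>n. fps_nth expK_fps i * scaled_coeff (Suc (n - i)))"
proof -
  have "fps_nth (fps_deriv expK_fps) n = fps_nth (expK_fps * fps_deriv ellK_fps) n"
    by (simp only: expK_fps_deriv)
  thus ?thesis
    by (simp only: fps_mult_nth ellK_fps_deriv_nth atLeast0AtMost) simp
qed

lemma expK_fps_pos: "fps_nth expK_fps n > 0"
proof (induction n rule: less_induct)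
  case (less n)
  show ?case
  proof (cases n)
    case (Suc k)
    have "(\<Sum>i\<le>k. fps_nth expK_fps i * scaled_coeff (Suc (k - i))) > 0"
      using less scaled_coeff_pos Suc by (intro sum_pos) auto
    thus ?thesis unfolding Suc expK_fps_nth_Suc[symmetric] by (simp add: zero_less_mult_iff)
  qed (simp add: expK_fps_nth_0)
qed

text \<open>
  The recursion averages the earlier coefficients with weights below \<open>1/2\<close>, so they
  stay bounded by the initial one, which gives convergence on the unit disc.
\<close>

lemma expK_fps_le: "fps_nth expK_fps n \<le> exp (pi / 2)"
proof (induction n rule: less_induct)
  case (less n)
  show ?case
  proof (cases n)
    case (Suc k)
    have "real (Suc k) * fps_nth expK_fps (Suc k) \<le> (\<Sum>i\<le>k. exp (pi / 2) * 1)"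
      unfolding expK_fps_nth_Suc
    proof (intro sum_mono mult_mono)
      fix i
      show "scaled_coeff (Suc (k - i)) \<le> 1"
        using scaled_coeff_less_half[of "Suc (k - i)"] by simp
    qed (use less Suc scaled_coeff_pos[THEN less_imp_le] in auto)
    also have "\<dots> = real (Suc k) * exp (pi / 2)" by simp
    finally show ?thesis unfolding Suc by (simp only: mult_le_cancel_left_pos of_nat_0_less_iff zero_less_Suc)
  qed (simp add: expK_fps_nth_0)
qed

lemma fps_conv_radius_ge_1:
  fixes f :: "real fps"
  assumes "\<And>n. \<bar>fps_nth f n\<bar> \<le> C"
  shows "fps_conv_radius f \<ge> 1"
  unfolding fps_conv_radius_def
proof (rule conv_radius_geI_ex')
  fix r :: real assume r: "0 < r" "ereal r < 1"
  have "summable (\<lambda>n. C * r ^ n)" using r by (intro summable_mult summable_geometric) auto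
  thus "summable (\<lambda>n. fps_nth f n * of_real r ^ n)"
  proof (rule summable_comparison_test'[where N = 0])
    fix n
    show "norm (fps_nth f n * of_real r ^ n) \<le> C * r ^ n"
      using r assms[of n] by (simp add: abs_mult power_abs mult_right_mono)
  qed
qed

lemma eval_fps_sums_unit:
  fixes f :: "real fps"
  assumes "fps_conv_radius f \<ge> 1" "0 \<le> x" "x < 1"
  shows "(\<lambda>n. fps_nth f n * x ^ n) sums eval_fps f x"
proof (rule sums_eval_fps)
  have "ereal (norm x) < 1" using assms by simp
  thus "ereal (norm x) < fps_conv_radius f" using assms(1) by (rule less_le_trans)
qed

lemma expK_fps_radius: "fps_conv_radius expK_fps \<ge> 1"
  using expK_fps_pos expK_fps_le by (intro fps_conv_radius_ge_1[of _ "exp (pi / 2)"]) (simp add: less_imp_le)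

lemma ellK_fps_radius: "fps_conv_radius ellK_fps \<ge> 1"
proof (rule fps_conv_radius_ge_1)
  fix n
  have "(wallis n)\<^sup>2 \<le> 1" using wallis_pos[of n] wallis_le_1[of n] by (simp add: power_le_one)
  thus "\<bar>fps_nth ellK_fps n\<bar> \<le> pi / 2"
    by (simp add: ellK_fps_def ellK_coeff_def abs_mult mult_left_le)
qed

lemma eval_ellK_fps:
  assumes "0 \<le> x" "x < 1"
  shows "eval_fps ellK_fps x = ellK (sqrt x)"
  using eval_fps_sums_unit[OF ellK_fps_radius assms] ellK_sums[OF assms]
  by (simp add: ellK_fps_def sums_iff)

text \<open>
  The composition theorem for formal series yields convergence only on a possibly smaller disc.
  Instead, both sides solve the differential equation \<open>F' = K' F\<close> with the same initial value.
\<close>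

lemma eval_expK_fps:
  assumes "0 \<le> x" "x < 1"
  shows "eval_fps expK_fps x = exp (ellK (sqrt x))"
proof -
  define g where "g = (\<lambda>x. eval_fps expK_fps x * exp (- eval_fps ellK_fps x))"
  have "(g has_real_derivative 0) (at y within {0..x})" if "y \<in> {0..x}" for y
  proof -
    have y: "0 \<le> y" "y < 1" using that assms by auto
    have y1: "ereal (norm y) < 1" using y by simp
    note r = less_le_trans[OF y1 ellK_fps_radius] less_le_trans[OF y1 expK_fps_radius]
      less_le_trans[OF less_le_trans[OF y1 ellK_fps_radius] fps_conv_radius_deriv]
    have "(eval_fps expK_fps has_real_derivative eval_fps expK_fps y * eval_fps (fps_deriv ellK_fps) y) (at y within {0..x})"
      using has_field_derivative_eval_fps[OF r(2), of "{0..x}"] r by (simp add: expK_fps_deriv eval_fps_mult)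
    moreover have "((\<lambda>y. exp (- eval_fps ellK_fps y)) has_real_derivative
        exp (- eval_fps ellK_fps y) * - eval_fps (fps_deriv ellK_fps) y) (at y within {0..x})"
      by (rule DERIV_chain2[OF DERIV_exp DERIV_minus[OF has_field_derivative_eval_fps[OF r(1)]]])
    ultimately show ?thesis
      unfolding g_def by (rule DERIV_cong[OF DERIV_mult]) simp
  qed
  then obtain c where c: "\<And>y. y \<in> {0..x} \<Longrightarrow> g y = c"
    using has_field_derivative_zero_constant[of "{0..x}" g] by auto
  have "g x = g 0" using c[of x] c[of 0] assms by auto
  also have "g 0 = 1"
    by (simp add: g_def eval_fps_at_0 expK_fps_nth_0 ellK_fps_def ellK_coeff_0 exp_minus)
  finally show ?thesis
    using eval_ellK_fps[OF assms] by (simp add: g_def exp_minus field_simps)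
qed

lemma expK_fps_sums:
  assumes "0 \<le> x" "x < 1"
  shows "(\<lambda>n. fps_nth expK_fps n * x ^ n) sums exp (ellK (sqrt x))"
  using eval_fps_sums_unit[OF expK_fps_radius assms] by (simp add: eval_expK_fps[OF assms])

text \<open>
  Summability on \<open>(0,1)\<close> alone gives radius of convergence at least \<open>1\<close>, hence continuity at \<open>0\<close>.
\<close>

lemma sums_tendsto_at_right_0:
  fixes c :: "nat \<Rightarrow> real"
  assumes "\<And>x. 0 < x \<Longrightarrow> x < 1 \<Longrightarrow> (\<lambda>n. c n * x ^ n) sums f x"
  shows "(f \<longlongrightarrow> c 0) (at_right 0)"
proof -
  define F where "F = Abs_fps c"
  have rad: "fps_conv_radius F \<ge> 1"
    unfolding fps_conv_radius_def F_def
    by (rule conv_radius_geI_ex') (use assms in \<open>auto simp: sums_iff\<close>)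
  have "isCont (eval_fps F) 0"
  proof (rule continuous_eval_fps)
    have "ereal (norm (0::real)) < 1" by simp
    thus "ereal (norm (0::real)) < fps_conv_radius F" using rad by (rule less_le_trans)
  qed
  hence "(eval_fps F \<longlongrightarrow> c 0) (at 0)"
    by (simp add: isCont_def eval_fps_at_0 F_def)
  hence "(eval_fps F \<longlongrightarrow> c 0) (at_right 0)"
    by (rule tendsto_within_subset) simp
  moreover have "\<forall>\<^sub>F x in at_right 0. eval_fps F x = f x"
    using eventually_at_right_real[OF zero_less_one]
    by (rule eventually_mono) (use assms in \<open>auto simp: F_def eval_fps_def sums_iff\<close>)
  ultimately show ?thesis by (rule Lim_transform_eventually)
qed

text \<open>
  Agreement on \<open>(0,1)\<close> determines the coefficients one after the other: divide the difference by the
  power of \<open>x\<close> that is already known to factor out, and let \<open>x\<close> tend to \<open>0\<close> from the right.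
\<close>

lemma power_series_unique:
  fixes a b :: "nat \<Rightarrow> real"
  assumes "\<And>x. 0 < x \<Longrightarrow> x < 1 \<Longrightarrow> (\<lambda>n. a n * x ^ n) sums f x"
    and "\<And>x. 0 < x \<Longrightarrow> x < 1 \<Longrightarrow> (\<lambda>n. b n * x ^ n) sums f x"
  shows "a = b"
proof -
  have "a n - b n = 0" for n
  proof (induction n rule: less_induct)
    case (less n)
    have "(\<lambda>k. (a (k + n) - b (k + n)) * x ^ k) sums 0" if x: "0 < x" "x < 1" for x
    proof -
      have "(\<lambda>k. (a k - b k) * x ^ k) sums 0"
        using sums_diff[OF assms(1)[OF x] assms(2)[OF x]] by (simp add: algebra_simps)
      moreover have "(\<Sum>k<n. (a k - b k) * x ^ k) = 0" using less by simp
      ultimately have "(\<lambda>k. (a (k + n) - b (k + n)) * x ^ (k + n)) sums 0"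
        using sums_split_initial_segment[of "\<lambda>k. (a k - b k) * x ^ k" 0 n] by simp
      from sums_mult[OF this, of "1 / x ^ n"] show ?thesis
        using x by (simp add: power_add)
    qed
    hence "((\<lambda>x. 0) \<longlongrightarrow> a (0 + n) - b (0 + n)) (at_right (0::real))"
      by (rule sums_tendsto_at_right_0)
    thus ?case by (simp add: tendsto_const_iff trivial_limit_at_right_real)
  qed
  thus ?thesis by (simp add: fun_eq_iff)
qed

text \<open>
  By uniqueness of power series, the formally defined coefficients are the \<open>b\<^sub>n\<close>.
\<close>

lemma expK_coeff_eq: "expK_coeff = fps_nth expK_fps"
  unfolding expK_coeff_def
proof (rule the_equality)
  show "\<forall>x\<in>{0<..<1}. (\<lambda>n. fps_nth expK_fps n * x ^ n) sums exp (ellK (sqrt x))"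
    using expK_fps_sums by auto
  show "b = fps_nth expK_fps" if "\<forall>x\<in>{0<..<1}. (\<lambda>n. b n * x ^ n) sums exp (ellK (sqrt x))" for b
    using that expK_fps_sums by (intro power_series_unique[where f = "\<lambda>x. exp (ellK (sqrt x))"]) auto
qed

section \<open>Monotonicity of the coefficient ratios\<close>

text \<open>
  Let \<open>F\<close> be the series of \<open>exp (K(\<surd>x))\<close>. Since \<open>W\<^bsub>n+1\<^esub>/W\<^sub>n = (n + 1/2)/(n + 1)\<close>, the claim says
  that \<open>D = (1 - x) F' - F/2 = F h\<close> with \<open>h = (1 - x) K' - 1/2\<close> has positive coefficients from
  index \<open>1\<close> on. The constant term of \<open>h\<close> is negative, so the product \<open>F h\<close> is inconclusive. But
  \<open>D' = F (K' h + h')\<close>, which discards the constant term of \<open>D\<close>, and here both factors have positive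
  coefficients: for the second one this is exactly \<open>convolution_bound\<close>.
\<close>

lemma expK_ratio_step:
  assumes "n \<ge> 1"
  shows "(real n + 1 / 2) * expK_coeff n < (real n + 1) * expK_coeff (Suc n)"
proof -
  define K' where "K' = fps_deriv ellK_fps"
  define h where "h = (1 - fps_X) * K' - fps_const (1 / 2)"
  define Q where "Q = K' * h + fps_deriv h"
  define D where "D = (1 - fps_X) * fps_deriv expK_fps - fps_const (1 / 2) * expK_fps"
  have K'_nth: "fps_nth K' k = scaled_coeff (Suc k)" for k
    by (simp only: K'_def ellK_fps_deriv_nth)
  have coeff_incr_nth: "fps_nth ((1 - fps_X) * K') k = coeff_incr k" for k
    by (cases k) (simp_all add: left_diff_distrib K'_nth coeff_incr_def)
  have "D = expK_fps * h"
    unfolding D_def h_def expK_fps_deriv K'_def by (simp add: algebra_simps)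
  hence D_deriv: "fps_deriv D = expK_fps * Q"
    unfolding Q_def by (simp add: expK_fps_deriv K'_def algebra_simps)
  have Q_pos: "fps_nth Q k > 0" for k
  proof -
    have "fps_nth (K' * h) k = fps_nth (((1 - fps_X) * K') * K') k - 1 / 2 * fps_nth K' k"
      unfolding h_def by (simp add: right_diff_distrib mult_ac)
    also have "\<dots> = (\<Sum>j\<le>k. coeff_incr j * scaled_coeff (Suc (k - j))) - 1 / 2 * (\<Sum>j\<le>k. coeff_incr j)"
      unfolding sum_coeff_incr by (simp only: fps_mult_nth[of "(1 - fps_X) * K'"] coeff_incr_nth K'_nth atLeast0AtMost)
    also have "\<dots> = - (\<Sum>j\<le>k. coeff_incr j * (1 / 2 - scaled_coeff (Suc (k - j))))"
      by (simp add: right_diff_distrib sum_subtractf sum_divide_distrib[symmetric])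
    finally have "fps_nth (K' * h) k = - (\<Sum>j\<le>k. coeff_incr j * (1 / 2 - scaled_coeff (Suc (k - j))))" .
    moreover have "fps_nth (fps_deriv h) k = (real k + 1) * coeff_incr (Suc k)"
    proof -
      have "fps_nth h (Suc k) = coeff_incr (Suc k)"
        unfolding h_def fps_sub_nth coeff_incr_nth by simp
      thus ?thesis by (simp add: add.commute)
    qed
    ultimately show ?thesis using convolution_bound[of k] by (simp add: Q_def)
  qed
  obtain k where k: "n = Suc k" using assms by (cases n) auto
  have "fps_nth (fps_deriv D) k = (\<Sum>i=0..k. fps_nth expK_fps i * fps_nth Q (k - i))"
    by (simp add: D_deriv fps_mult_nth)
  also have "\<dots> > 0"
    using expK_fps_pos Q_pos by (intro sum_pos) auto
  finally have "fps_nth D n > 0"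
    by (simp add: k zero_less_mult_iff)
  moreover have "fps_nth D n = (real n + 1) * expK_coeff (Suc n) - (real n + 1 / 2) * expK_coeff n"
    by (simp add: D_def k expK_coeff_eq algebra_simps)
  ultimately show ?thesis by simp
qed

lemma expK_wallis_ratio_Suc:
  assumes "n \<ge> 1"
  shows "expK_coeff n / wallis n < expK_coeff (Suc n) / wallis (Suc n)"
proof -
  have "expK_coeff n / wallis n = ((real n + 1 / 2) * expK_coeff n) / ((real n + 1 / 2) * wallis n)"
    by simp
  also have "\<dots> < ((real n + 1) * expK_coeff (Suc n)) / ((real n + 1 / 2) * wallis n)"
    using expK_ratio_step[OF assms] wallis_pos[of n] by (intro divide_strict_right_mono) auto
  also have "(real n + 1 / 2) * wallis n = (real n + 1) * wallis (Suc n)"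
    by (simp add: wallis_Suc field_simps)
  finally show ?thesis by simp
qed

lemma expK_wallis_ratio_less:
  assumes "1 \<le> m" "m < n"
  shows "expK_coeff m / wallis m < expK_coeff n / wallis n"
  using assms(2,1)
proof (induction rule: strict_inc_induct)
  case (base i)
  thus ?case using expK_wallis_ratio_Suc by simp
next
  case (step i)
  thus ?case using expK_wallis_ratio_Suc[of i] by simp
qed

section \<open>Sharp bounds with matched Taylor polynomials\<close>

text \<open>
  The multiple \<open>p / \<surd>(1 - x)\<close> of the comparison function, corrected by a polynomial so that it has
  the same Taylor polynomial of degree \<open>m\<close> as \<open>exp (K(\<surd>x))\<close>. The argument is \<open>x = r\<^sup>2\<close>.
\<close>

definition taylor_matched :: "nat \<Rightarrow> real \<Rightarrow> real \<Rightarrow> real" where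
  "taylor_matched m p x = p / sqrt (1 - x) + (\<Sum>n=0..m. remainder_coeff p n * x ^ n)"

lemma taylor_matched_boundary:
  "((\<lambda>x. sqrt (1 - x) * taylor_matched m p x) \<longlongrightarrow> p) (at_left 1)"
proof -
  have "((\<lambda>x::real. p + sqrt (1 - x) * (\<Sum>n=0..m. remainder_coeff p n * x ^ n)) \<longlongrightarrow>
      p + sqrt (1 - 1) * (\<Sum>n=0..m. remainder_coeff p n * 1 ^ n)) (at_left 1)"
    by (intro tendsto_intros)
  moreover have "\<forall>\<^sub>F x::real in at_left 1. p + sqrt (1 - x) * (\<Sum>n=0..m. remainder_coeff p n * x ^ n)
      = sqrt (1 - x) * taylor_matched m p x"
    using eventually_at_left_real[OF zero_less_one]
    by (rule eventually_mono) (simp add: taylor_matched_def distrib_left)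
  ultimately show ?thesis
    by (auto dest: Lim_transform_eventually)
qed

text \<open>
  The factored form displays the sign of each coefficient, which is that of
  \<open>b\<^sub>n / W\<^sub>n - p\<close>.
\<close>

lemma remainder_ratio_sums:
  assumes x: "0 < x" "x < 1"
  shows "(\<lambda>k. wallis (k + Suc m) * (expK_coeff (k + Suc m) / wallis (k + Suc m) - p) * x ^ k) sums
     ((exp (ellK (sqrt x)) - taylor_matched m p x) / x ^ Suc m)"
proof -
  have "(\<lambda>n. remainder_coeff p n * x ^ n) sums (exp (ellK (sqrt x)) - p * (1 / sqrt (1 - x)))"
    using sums_diff[OF expK_fps_sums[of x] sums_mult[OF wallis_sums[of x], of p]] x
    by (simp add: remainder_coeff_def expK_coeff_eq left_diff_distrib mult.assoc)
  from sums_divide[OF sums_split_initial_segment[OF this, of "Suc m"], of "x ^ Suc m"]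
  have "(\<lambda>k. (expK_coeff (k + Suc m) - p * wallis (k + Suc m)) * x ^ k) sums
     ((exp (ellK (sqrt x)) - taylor_matched m p x) / x ^ Suc m)"
    using x by (simp add: taylor_matched_def remainder_coeff_def power_add lessThan_Suc_atMost
        atLeast0AtMost diff_diff_add)
  thus ?thesis
    using wallis_pos by (simp add: right_diff_distrib mult.commute[of p] less_imp_neq[symmetric])
qed

lemma lower_bound_imp_le_4:
  assumes "\<And>x. 0 < x \<Longrightarrow> x < 1 \<Longrightarrow> taylor_matched m p x \<le> exp (ellK (sqrt x))"
  shows "p \<le> 4"
proof (rule tendsto_le[OF _ expK_asymptotic taylor_matched_boundary])
  show "\<forall>\<^sub>F x in at_left 1. sqrt (1 - x) * taylor_matched m p x \<le> sqrt (1 - x) * exp (ellK (sqrt x))"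
    using eventually_at_left_real[OF zero_less_one]
    by (rule eventually_mono) (use assms in \<open>auto intro: mult_left_mono\<close>)
qed (rule trivial_limit_at_left_real)

lemma upper_bound_imp_ge_4:
  assumes "\<And>x. 0 < x \<Longrightarrow> x < 1 \<Longrightarrow> exp (ellK (sqrt x)) \<le> taylor_matched m q x"
  shows "4 \<le> q"
proof (rule tendsto_le[OF _ taylor_matched_boundary expK_asymptotic])
  show "\<forall>\<^sub>F x in at_left 1. sqrt (1 - x) * exp (ellK (sqrt x)) \<le> sqrt (1 - x) * taylor_matched m q x"
    using eventually_at_left_real[OF zero_less_one]
    by (rule eventually_mono) (use assms in \<open>auto intro: mult_left_mono\<close>)
qed (rule trivial_limit_at_left_real)

text \<open>
  The remainder divided by \<open>x\<^bsup>m+1\<^esup>\<close> tends to its first coefficient as \<open>x\<close> tends to \<open>0\<close>, so that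
  coefficient cannot be negative. Conversely, if it is not, then all later ones are positive because
  the ratios \<open>b\<^sub>n / W\<^sub>n\<close> increase.
\<close>

lemma lower_bound_iff:
  "(\<forall>x\<in>{0<..<1}. taylor_matched m p x < exp (ellK (sqrt x))) \<longleftrightarrow>
     p \<le> expK_coeff (Suc m) / wallis (Suc m)"
proof
  assume lower: "\<forall>x\<in>{0<..<1}. taylor_matched m p x < exp (ellK (sqrt x))"
  have "((\<lambda>x. (exp (ellK (sqrt x)) - taylor_matched m p x) / x ^ Suc m) \<longlongrightarrow>
      wallis (0 + Suc m) * (expK_coeff (0 + Suc m) / wallis (0 + Suc m) - p)) (at_right 0)"
    by (rule sums_tendsto_at_right_0[OF remainder_ratio_sums])
  moreover have "\<forall>\<^sub>F x in at_right 0. 0 \<le> (exp (ellK (sqrt x)) - taylor_matched m p x) / x ^ Suc m"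
    using eventually_at_right_real[OF zero_less_one]
    by (rule eventually_mono) (use lower in \<open>auto intro!: divide_nonneg_pos simp: less_imp_le\<close>)
  ultimately have "0 \<le> wallis (0 + Suc m) * (expK_coeff (0 + Suc m) / wallis (0 + Suc m) - p)"
    by (rule tendsto_lowerbound) (rule trivial_limit_at_right_real)
  thus "p \<le> expK_coeff (Suc m) / wallis (Suc m)"
    using wallis_pos[of "Suc m"] by (simp add: zero_le_mult_iff)
next
  assume p: "p \<le> expK_coeff (Suc m) / wallis (Suc m)"
  show "\<forall>x\<in>{0<..<1}. taylor_matched m p x < exp (ellK (sqrt x))"
  proof
    fix x :: real assume "x \<in> {0<..<1}"
    hence x: "0 < x" "x < 1" by auto
    define c where "c = (\<lambda>k. wallis (k + Suc m) * (expK_coeff (k + Suc m) / wallis (k + Suc m) - p) * x ^ k)"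
    have ratio: "expK_coeff (Suc m) / wallis (Suc m) < expK_coeff (k + Suc m) / wallis (k + Suc m)"
      if "k > 0" for k
      using that by (intro expK_wallis_ratio_less) auto
    have "c k \<ge> 0" for k
      unfolding c_def using p ratio[of k] wallis_pos[of "k + Suc m"] x
      by (cases "k = 0") (auto intro!: mult_nonneg_nonneg)
    moreover have "c 1 > 0"
      unfolding c_def using p ratio[of 1] wallis_pos[of "1 + Suc m"] x
      by (intro mult_pos_pos) auto
    moreover have c: "c sums ((exp (ellK (sqrt x)) - taylor_matched m p x) / x ^ Suc m)"
      unfolding c_def by (rule remainder_ratio_sums[OF x])
    ultimately have "(exp (ellK (sqrt x)) - taylor_matched m p x) / x ^ Suc m > 0"
      using suminf_pos2[of c 1] by (simp add: sums_iff)
    thus "taylor_matched m p x < exp (ellK (sqrt x))"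
      using zero_less_power[of x "Suc m"] x by (simp add: zero_less_divide_iff del: power_Suc)
  qed
qed

text \<open>
  By \<open>lower_bound_iff\<close> the next ratio is an admissible constant in a lower bound, and the behaviour at
  \<open>x = 1\<close> forces such constants to be at most \<open>4\<close>. Strict monotonicity excludes equality.
\<close>

lemma expK_wallis_ratio_less_4:
  assumes "n \<ge> 1"
  shows "expK_coeff n / wallis n < 4"
proof -
  have "expK_coeff n / wallis n < expK_coeff (Suc n) / wallis (Suc n)"
    by (rule expK_wallis_ratio_Suc[OF assms])
  also have "\<dots> \<le> 4"
  proof (rule lower_bound_imp_le_4)
    fix x :: real assume "0 < x" "x < 1"
    thus "taylor_matched n (expK_coeff (Suc n) / wallis (Suc n)) x \<le> exp (ellK (sqrt x))"
      using lower_bound_iff[of n "expK_coeff (Suc n) / wallis (Suc n)"] by (auto intro: less_imp_le)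
  qed
  finally show ?thesis .
qed

text \<open>
  For \<open>q \<ge> 4\<close> every coefficient of the remainder is negative; the converse is read off at \<open>x = 1\<close>.
\<close>

lemma upper_bound_iff:
  "(\<forall>x\<in>{0<..<1}. exp (ellK (sqrt x)) < taylor_matched m q x) \<longleftrightarrow> 4 \<le> q"
proof
  assume "\<forall>x\<in>{0<..<1}. exp (ellK (sqrt x)) < taylor_matched m q x"
  thus "4 \<le> q"
    by (intro upper_bound_imp_ge_4[of m q]) (auto intro: less_imp_le)
next
  assume q: "4 \<le> q"
  show "\<forall>x\<in>{0<..<1}. exp (ellK (sqrt x)) < taylor_matched m q x"
  proof
    fix x :: real assume "x \<in> {0<..<1}"
    hence x: "0 < x" "x < 1" by auto
    define c where "c = (\<lambda>k. wallis (k + Suc m) * (expK_coeff (k + Suc m) / wallis (k + Suc m) - q) * x ^ k)"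
    have c: "c sums ((exp (ellK (sqrt x)) - taylor_matched m q x) / x ^ Suc m)"
      unfolding c_def by (rule remainder_ratio_sums[OF x])
    have "c k < 0" for k
      unfolding c_def using q expK_wallis_ratio_less_4[of "k + Suc m"] wallis_pos[of "k + Suc m"] x
      by (intro mult_neg_pos mult_pos_neg) auto
    hence "suminf (\<lambda>k. - c k) > 0"
      using sums_minus[OF c] by (intro suminf_pos) (auto simp: sums_iff)
    hence "(exp (ellK (sqrt x)) - taylor_matched m q x) / x ^ Suc m < 0"
      using sums_minus[OF c] by (simp add: sums_iff)
    thus "exp (ellK (sqrt x)) < taylor_matched m q x"
      using zero_less_power[of x "Suc m"] x by (simp add: divide_less_0_iff del: power_Suc)
  qed
qed

section \<open>From exponentials to logarithms\<close>

lemma ext_ln_less_iff: "ext_ln s < ereal k \<longleftrightarrow> s < exp k"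
proof (cases "s > 0")
  case True
  have "ln s < k \<longleftrightarrow> exp (ln s) < exp k" by (simp only: exp_less_cancel_iff)
  thus ?thesis using True by (simp add: ext_ln_def)
next
  case False
  hence "s < exp k" using exp_gt_zero[of k] by linarith
  thus ?thesis using False by (simp add: ext_ln_def)
qed

lemma less_ext_ln_iff: "ereal k < ext_ln s \<longleftrightarrow> exp k < s"
proof (cases "s > 0")
  case True
  have "k < ln s \<longleftrightarrow> exp k < exp (ln s)" by (simp only: exp_less_cancel_iff)
  thus ?thesis using True by (simp add: ext_ln_def)
next
  case False
  hence "\<not> exp k < s" using exp_gt_zero[of k] by linarith
  thus ?thesis using False by (simp add: ext_ln_def)
qed

theorem proposition1:
  fixes m :: nat and p q :: real
  shows "(\<forall>r\<in>{0<..<1::real}.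
            ext_ln (p / sqrt (1 - r\<^sup>2) + (\<Sum>n=0..m. remainder_coeff p n * r ^ (2 * n))) < ereal (ellK r) \<and>
            ereal (ellK r) < ext_ln (q / sqrt (1 - r\<^sup>2) + (\<Sum>n=0..m. remainder_coeff q n * r ^ (2 * n))))
         \<longleftrightarrow> p \<le> expK_coeff (m + 1) / wallis (m + 1) \<and> q \<ge> 4"
    (is "(\<forall>r\<in>_. ?P r) \<longleftrightarrow> _")
proof -
  define Q where "Q = (\<lambda>x. taylor_matched m p x < exp (ellK (sqrt x)) \<and> exp (ellK (sqrt x)) < taylor_matched m q x)"
  have P_iff: "?P r \<longleftrightarrow> Q (r\<^sup>2)" if "0 < r" for r
    unfolding ext_ln_less_iff less_ext_ln_iff Q_def taylor_matched_def
    using that by (simp add: power_mult)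
  have "(\<forall>r\<in>{0<..<1}. ?P r) \<longleftrightarrow> (\<forall>x\<in>{0<..<1}. Q x)"
  proof safe
    fix x :: real assume P: "\<forall>r\<in>{0<..<1}. ?P r" and x: "x \<in> {0<..<1}"
    have "sqrt x \<in> {0<..<1}" using x by simp
    with P have "?P (sqrt x)" by (rule bspec)
    hence "Q ((sqrt x)\<^sup>2)" using P_iff[of "sqrt x"] x by auto
    thus "Q x" using x by simp
  next
    fix r :: real assume Q: "\<forall>x\<in>{0<..<1}. Q x" and r: "r \<in> {0<..<1}"
    hence "r\<^sup>2 \<in> {0<..<1}" by (auto simp: abs_square_less_1)
    hence "?P r" using Q P_iff[of r] r by auto
    thus "ext_ln (p / sqrt (1 - r\<^sup>2) + (\<Sum>n=0..m. remainder_coeff p n * r ^ (2 * n))) < ereal (ellK r)"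
      "ereal (ellK r) < ext_ln (q / sqrt (1 - r\<^sup>2) + (\<Sum>n=0..m. remainder_coeff q n * r ^ (2 * n)))"
      by auto
  qed
  also have "\<dots> \<longleftrightarrow> p \<le> expK_coeff (m + 1) / wallis (m + 1) \<and> q \<ge> 4"
    using lower_bound_iff[of m p] upper_bound_iff[of m q] unfolding Q_def by auto
  finally show ?thesis .
qed

end
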